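(* There exists $n_0$ such that for every integer $n\ge n_0$ the following holds. Let $\mathbf{T}=(T_1,\dots,T_{n-1})$ be any collection of $n-1$ (not necessarily distinct) tournaments on a common vertex set $V$ with $|V|=n$. Then there is a $\mathbf{T}$-transversal that is a directed Hamilton path on $V$.
   Context: A tournament on a finite vertex set $V$ is an orientation of the complete graph on $V$ (exactly one of the arcs $\overrightarrow{uv},\overrightarrow{vu}$ is present for each pair of distinct $u,v\in V$). For a collection $\mathbf{T}=(T_1,\dots,T_m)$ of tournaments on a common vertex set $V$, an $m$-edge directed graph $\mathcal{D}$ with vertices in $V$ is a $\mathbf{T}$-transversal if there is a bijection $\phi:E(\mathcal{D})\to[m]=\{1,\dots,m\}$ with $e\in E(T_{\phi(e)})$ for all $e\in E(\mathcal{D})$. A directed Hamilton path on $V$ is a directed path $v_1\to v_2\to\cdots\to v_n$ (all arcs $\overrightarrow{v_iv_{i+1}}$) visiting every vertex of $V$ exactly once. *)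

theory Defs
  imports "Graph_Theory.Pair_Digraph" "Graph_Theory.Vertex_Walk"
begin

text \<open>The finite vertex set, well-formedness and absence of loops come from \<^locale>\<open>pair_digraph\<close>.\<close>

locale tournament = pair_digraph +
  assumes exactly_one_arc:
    "\<And>u v. u \<in> pverts G \<Longrightarrow> v \<in> pverts G \<Longrightarrow> u \<noteq> v \<Longrightarrow>
      ((u, v) \<in> parcs G) \<noteq> ((v, u) \<in> parcs G)"

text \<open>
  A collection \<open>(T\<^sub>1, \<dots>, T\<^sub>m)\<close> is a function on the naturals of which only
  the values on \<open>{1..m}\<close> matter; the members may coincide.
\<close>

definition tournament_collection ::
    "'a set \<Rightarrow> nat \<Rightarrow> (nat \<Rightarrow> 'a pair_pre_digraph) \<Rightarrow> bool" where
  "tournament_collection V m T \<longleftrightarrow> (\<forall>i\<in>{1..m}. tournament (T i) \<and> pverts (T i) = V)"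

definition transversal ::
    "'a set \<Rightarrow> nat \<Rightarrow> (nat \<Rightarrow> 'a pair_pre_digraph) \<Rightarrow> 'a pair_pre_digraph \<Rightarrow> bool" where
  "transversal V m T D \<longleftrightarrow>
     pair_digraph D \<and> pverts D \<subseteq> V \<and> card (parcs D) = m \<and>
     (\<exists>\<phi>. bij_betw \<phi> (parcs D) {1..m} \<and> (\<forall>e\<in>parcs D. e \<in> parcs (T (\<phi> e))))"

text \<open>
  Here \<open>D\<close> itself is the path, so it has no arcs besides those
  joining consecutive vertices.
\<close>

definition directed_hamilton_path :: "'a set \<Rightarrow> 'a pair_pre_digraph \<Rightarrow> bool" where
  "directed_hamilton_path V D \<longleftrightarrow>
     pverts D = V \<and>
     (\<exists>vs. vpath vs (with_proj D) \<and> set vs = V \<and> parcs D = set (vwalk_arcs vs))"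

end

theory Submission
  imports Defs
begin

text \<open>
  A rainbow path can absorb a further vertex \<open>v\<close> with two spare colours \<open>c\<close>, \<open>c'\<close>
  as soon as it has consecutive vertices \<open>x\<close>, \<open>y\<close> with \<open>x \<rightarrow> v\<close> in one and
  \<open>v \<rightarrow> y\<close> in the other spare colour; the colour of \<open>xy\<close> becomes spare again.
  If there is no such gap and \<open>v\<close> cannot be put at an end, both spare colours are forced to treat
  the path uniformly.  Hence only the very last vertex, for which a single colour is
  left, is problematic.

  To handle it, reserve a colour \<open>d\<close> and vertices \<open>a\<close>, \<open>b\<close>, \<open>w\<close> with \<open>a \<rightarrow> w\<close> and \<open>b \<rightarrow> w\<close>
  in \<open>d\<close>: whichever colour remains for the pair \<open>a\<close>, \<open>b\<close>, one of them precedes the other,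
  and \<open>d\<close> leads from there to \<open>w\<close>. Now take a longest rainbow path that starts
  at \<open>w\<close> and avoids \<open>a\<close>, \<open>b\<close>, \<open>d\<close>. If \<open>Z\<close> and \<open>E\<close> are the unused
  vertices and colours, then \<open>|E| = |Z| + 1\<close>, and maximality makes every vertex of \<open>Z\<close> point to
  \<open>w\<close> in every colour of \<open>E\<close>. It remains to find a rainbow Hamilton path
  on \<open>Z \<union> {a, b}\<close> that leaves out a colour of \<open>E\<close> and ends in \<open>Z\<close>, or leaves out \<open>d\<close> and ends in
  \<open>{a, b}\<close>. Take a path on \<open>Z\<close> with two spare colours \<open>e\<close>, \<open>e'\<close> of \<open>E\<close>.
  If \<open>b\<close> can be inserted other than at the end, then \<open>a\<close> can be added as well, where \<open>d\<close> serves as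
  the second spare colour; likewise with \<open>a\<close> and \<open>b\<close> exchanged. Otherwise the last vertex
  points to both \<open>a\<close> and \<open>b\<close> in both \<open>e\<close> and \<open>e'\<close>, and the path continues through \<open>a\<close> and \<open>b\<close>.
\<close>

section \<open>Rainbow paths: joining, splitting and colour assignment\<close>

text \<open>Only the set \<open>K\<close> of colours is recorded, each used once; which arc has
  which colour is recovered at the end.\<close>

inductive rainbow_path :: "('c \<Rightarrow> 'v \<Rightarrow> 'v \<Rightarrow> bool) \<Rightarrow> 'v list \<Rightarrow> 'c set \<Rightarrow> bool"
  for arc where
  single: "rainbow_path arc [v] {}"
| step: "rainbow_path arc vs K \<Longrightarrow> u \<notin> set vs \<Longrightarrow> c \<notin> K \<Longrightarrow> arc c u (hd vs) \<Longrightarrow>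
    rainbow_path arc (u # vs) (insert c K)"

lemma rainbow_path_ne: "rainbow_path arc vs K \<Longrightarrow> vs \<noteq> []"
  by (induction rule: rainbow_path.induct) auto

lemma rainbow_path_distinct: "rainbow_path arc vs K \<Longrightarrow> distinct vs"
  by (induction rule: rainbow_path.induct) auto

lemma rainbow_path_finite: "rainbow_path arc vs K \<Longrightarrow> finite K"
  by (induction rule: rainbow_path.induct) auto

lemma rainbow_path_length: "rainbow_path arc vs K \<Longrightarrow> length vs = Suc (card K)"
  by (induction rule: rainbow_path.induct) (auto simp: rainbow_path_finite)

lemma rainbow_path_card: "rainbow_path arc vs K \<Longrightarrow> card (set vs) = Suc (card K)"
  by (metis distinct_card rainbow_path_distinct rainbow_path_length)

lemma rainbow_path_join:
  assumes "rainbow_path arc us K" "rainbow_path arc vs L" "set us \<inter> set vs = {}"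
    "K \<inter> L = {}" "c \<notin> K" "c \<notin> L" "arc c (last us) (hd vs)"
  shows "rainbow_path arc (us @ vs) (insert c (K \<union> L))"
  using assms
proof (induction rule: rainbow_path.induct)
  case (single v)
  then show ?case by (auto intro: rainbow_path.step)
next
  case (step ws K u e)
  then have "ws \<noteq> []" by (simp add: rainbow_path_ne)
  then have "rainbow_path arc (ws @ vs) (insert c (K \<union> L))" "hd (ws @ vs) = hd ws"
    using step by auto
  then have "rainbow_path arc (u # (ws @ vs)) (insert e (insert c (K \<union> L)))"
    using step by (intro rainbow_path.step) auto
  then show ?case by (simp add: insert_commute)
qed

text \<open>Cutting loses exactly one colour, \<open>c\<close>, that of the arc between the two
  parts.\<close>

lemma rainbow_path_split:
  assumes "rainbow_path arc (us @ vs) K" "us \<noteq> []" "vs \<noteq> []"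
  obtains L M c where "rainbow_path arc us L" "rainbow_path arc vs M"
    "K = insert c (L \<union> M)" "c \<notin> L" "c \<notin> M" "L \<inter> M = {}"
proof -
  have "\<exists>L M c. rainbow_path arc us L \<and> rainbow_path arc vs M \<and>
    K = insert c (L \<union> M) \<and> c \<notin> L \<and> c \<notin> M \<and> L \<inter> M = {}"
    using assms
  proof (induction us arbitrary: K)
    case (Cons u us)
    from Cons.prems(1,3) obtain K' e where K: "K = insert e K'" "e \<notin> K'"
      "rainbow_path arc (us @ vs) K'" "u \<notin> set (us @ vs)" "arc e u (hd (us @ vs))"
      by (auto elim: rainbow_path.cases)
    show ?case
    proof (cases "us = []")
      case True
      then have "rainbow_path arc [u] {} \<and> rainbow_path arc vs K' \<and>
        K = insert e ({} \<union> K') \<and> e \<notin> {} \<and> e \<notin> K' \<and> {} \<inter> K' = {}"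
        using K by (auto intro: rainbow_path.single)
      with True show ?thesis by blast
    next
      case False
      then obtain L M c where *: "rainbow_path arc us L" "rainbow_path arc vs M"
        "K' = insert c (L \<union> M)" "c \<notin> L" "c \<notin> M" "L \<inter> M = {}"
        using Cons.IH K Cons.prems by blast
      then have "rainbow_path arc (u # us) (insert e L)"
        using K False by (intro rainbow_path.step) auto
      moreover have "K = insert c (insert e L \<union> M)" "c \<notin> insert e L" "insert e L \<inter> M = {}"
        using * K by auto
      ultimately show ?thesis using * by blast
    qed
  qed simp
  then show ?thesis using that by blast
qed

lemma rainbow_path_snoc:
  assumes "rainbow_path arc vs K" "v \<notin> set vs" "c \<notin> K" "arc c (last vs) v"
  shows "rainbow_path arc (vs @ [v]) (insert c K)"
  using rainbow_path_join[OF assms(1) rainbow_path.single, of v c] assms by auto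

lemma vwalk_arcs_verts: "(x, y) \<in> set (vwalk_arcs vs) \<Longrightarrow> x \<in> set vs \<and> y \<in> set vs"
  by (induction vs rule: vwalk_arcs.induct) auto

lemma rainbow_path_transversal:
  assumes "rainbow_path arc vs K"
  shows "\<exists>\<phi>. bij_betw \<phi> (set (vwalk_arcs vs)) K \<and>
    (\<forall>(u, v) \<in> set (vwalk_arcs vs). arc (\<phi> (u, v)) u v)"
  using assms
proof (induction rule: rainbow_path.induct)
  case (single v)
  then show ?case by (auto simp: bij_betw_def)
next
  case (step vs K u c)
  then obtain \<phi> where \<phi>: "bij_betw \<phi> (set (vwalk_arcs vs)) K"
    "\<And>x y. (x, y) \<in> set (vwalk_arcs vs) \<Longrightarrow> arc (\<phi> (x, y)) x y" by blast
  have ne: "vs \<noteq> []" using step rainbow_path_ne by blast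
  have new: "(u, hd vs) \<notin> set (vwalk_arcs vs)" using step.hyps vwalk_arcs_verts by fast
  let ?\<psi> = "\<phi>((u, hd vs) := c)"
  have "bij_betw ?\<psi> (set (vwalk_arcs vs)) K"
    using \<phi>(1) new by (subst bij_betw_cong[where g = \<phi>]) auto
  then have "bij_betw ?\<psi> (insert (u, hd vs) (set (vwalk_arcs vs))) (insert c K)"
    using bij_betw_combine[of ?\<psi> _ K "{(u, hd vs)}" "{c}"] step.hyps by (simp add: bij_betw_def)
  moreover have "\<forall>(x, y) \<in> insert (u, hd vs) (set (vwalk_arcs vs)). arc (?\<psi> (x, y)) x y"
    using \<phi>(2) step.hyps by auto
  ultimately have "bij_betw ?\<psi> (set (vwalk_arcs (u # vs))) (insert c K) \<and>
    (\<forall>(x, y) \<in> set (vwalk_arcs (u # vs)). arc (?\<psi> (x, y)) x y)"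
    using ne by simp
  then show ?case by blast
qed

section \<open>Inserting a vertex with two spare colours\<close>

locale coloured_tournaments =
  fixes arc :: "'c \<Rightarrow> 'v \<Rightarrow> 'v \<Rightarrow> bool" and C :: "'c set" and V :: "'v set"
  assumes total: "c \<in> C \<Longrightarrow> u \<in> V \<Longrightarrow> v \<in> V \<Longrightarrow> u \<noteq> v \<Longrightarrow> arc c u v \<or> arc c v u"
begin

abbreviation rainbow where "rainbow \<equiv> rainbow_path arc"

definition fits :: "'v \<Rightarrow> 'c \<Rightarrow> 'c \<Rightarrow> 'v list \<Rightarrow> bool" where
  "fits v c c' vs \<longleftrightarrow> (\<exists>xs ys. vs = xs @ ys \<and> xs \<noteq> [] \<and> ys \<noteq> [] \<and>
     arc c (last xs) v \<and> arc c' v (hd ys))"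

lemma fitsI:
  "xs \<noteq> [] \<Longrightarrow> ys \<noteq> [] \<Longrightarrow> arc c (last xs) v \<Longrightarrow> arc c' v (hd ys) \<Longrightarrow> fits v c c' (xs @ ys)"
  unfolding fits_def by blast

lemma fits_append1: "fits v c c' ys \<Longrightarrow> fits v c c' (xs @ ys)"
  unfolding fits_def
  by (elim exE conjE, rule_tac x = "xs @ xsa" in exI, rule_tac x = ysa in exI) auto

lemma fits_append2: "fits v c c' xs \<Longrightarrow> fits v c c' (xs @ ys)"
  unfolding fits_def
  by (elim exE conjE, rule_tac x = xsa in exI, rule_tac x = "ysa @ ys" in exI) auto

text \<open>Routing the gap through \<open>v\<close> frees \<open>f\<close>, the colour of the arc
  broken up. The gap is interior, so both ends stay.\<close>

lemma fits_insert:
  assumes "rainbow vs K" "v \<notin> set vs" "c \<noteq> c'" "c \<notin> K" "c' \<notin> K" "fits v c c' vs"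
  obtains ws f where "rainbow ws (insert c (insert c' (K - {f})))" "f \<in> K"
    "set ws = insert v (set vs)" "hd ws = hd vs" "last ws = last vs"
proof -
  from assms(6) obtain xs ys where vs: "vs = xs @ ys" "xs \<noteq> []" "ys \<noteq> []"
    "arc c (last xs) v" "arc c' v (hd ys)" unfolding fits_def by blast
  with assms(1) obtain L M f where LM: "rainbow xs L" "rainbow ys M"
    "K = insert f (L \<union> M)" "f \<notin> L" "f \<notin> M" "L \<inter> M = {}"
    by (blast elim: rainbow_path_split)
  have "rainbow (v # ys) (insert c' M)"
    using LM vs assms by (intro rainbow_path.step) auto
  then have "rainbow (xs @ v # ys) (insert c (L \<union> insert c' M))"
    using LM vs assms rainbow_path_distinct[OF assms(1)] by (intro rainbow_path_join) auto
  moreover have "insert c (L \<union> insert c' M) = insert c (insert c' (K - {f}))"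
    using LM by auto
  ultimately show ?thesis using that[of "xs @ v # ys" f] vs LM by auto
qed

text \<open>If a vertex points to \<open>v\<close> in both colours, an arc from \<open>v\<close> to
  its successor in either colour would complete a gap with the other, so by totality the successor
  points to \<open>v\<close> in both.\<close>

lemma no_fit_forward:
  assumes "set vs \<subseteq> V" "v \<in> V" "v \<notin> set vs" "c \<in> C" "c' \<in> C"
    "\<not> fits v c c' vs" "\<not> fits v c' c vs" "arc c (hd vs) v" "arc c' (hd vs) v" "x \<in> set vs"
  shows "arc c x v \<and> arc c' x v"
  using assms
proof (induction vs)
  case (Cons y vs)
  show ?case
  proof (cases "vs = []")
    case False
    have "\<not> fits v c c' vs" "\<not> fits v c' c vs"
      using Cons.prems(6,7) fits_append1[of v _ _ vs "[y]"] by auto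
    moreover have "\<not> arc c v (hd vs)" "\<not> arc c' v (hd vs)"
      using Cons.prems(6-9) False fitsI[of "[y]" vs] by auto
    then have "arc c (hd vs) v" "arc c' (hd vs) v"
      using total[of c v "hd vs"] total[of c' v "hd vs"] Cons.prems hd_in_set[OF False]
      by (auto simp: subset_iff)
    ultimately show ?thesis using Cons by auto
  qed (use Cons in auto)
qed simp

lemma no_fit_backward:
  assumes "set vs \<subseteq> V" "v \<in> V" "v \<notin> set vs" "c \<in> C" "c' \<in> C"
    "\<not> fits v c c' vs" "\<not> fits v c' c vs" "arc c v (last vs)" "arc c' v (last vs)" "x \<in> set vs"
  shows "arc c v x \<and> arc c' v x"
  using assms
proof (induction vs rule: rev_induct)
  case (snoc y vs)
  show ?case
  proof (cases "vs = []")
    case False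
    have "\<not> fits v c c' vs" "\<not> fits v c' c vs"
      using snoc.prems(6,7) fits_append2[of v _ _ vs "[y]"] by auto
    moreover have "\<not> arc c (last vs) v" "\<not> arc c' (last vs) v"
      using snoc.prems(6-9) False fitsI[of vs "[y]"] by auto
    then have "arc c v (last vs)" "arc c' v (last vs)"
      using total[of c v "last vs"] total[of c' v "last vs"] snoc.prems last_in_set[OF False]
      by (auto simp: subset_iff)
    ultimately show ?thesis using snoc by auto
  qed (use snoc in auto)
qed simp

text \<open>\<open>v\<close> goes to the front or into a gap, so the last vertex stays;
  \<open>f\<close> is the colour left spare. If neither works, \<open>hd R\<close> points to
  \<open>v\<close> in both colours and \<open>no_fit_forward\<close> carries this along
  \<open>R\<close>.\<close>

lemma extend_inside:
  assumes R: "rainbow R K" "set R \<subseteq> V" and v: "v \<in> V" "v \<notin> set R"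
    and e: "e \<in> C" "e' \<in> C" "e \<noteq> e'" "e \<notin> K" "e' \<notin> K"
  shows "(\<exists>vs L f. rainbow vs L \<and> set vs = insert v (set R) \<and> last vs = last R \<and>
      insert f L = insert e (insert e' K) \<and> f \<notin> L) \<or>
    (\<forall>x\<in>set R. arc e x v \<and> arc e' x v)"
proof -
  have ne: "R \<noteq> []" using R rainbow_path_ne by blast
  consider "arc e v (hd R)" | "arc e' v (hd R)" | "fits v e e' R" | "fits v e' e R"
    | "\<not> arc e v (hd R)" "\<not> arc e' v (hd R)" "\<not> fits v e e' R" "\<not> fits v e' e R" by blast
  then show ?thesis
  proof cases
    case 1
    then have "rainbow (v # R) (insert e K)" using R v e by (intro rainbow_path.step)
    moreover have "insert e' (insert e K) = insert e (insert e' K)" "e' \<notin> insert e K" using e by auto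
    moreover have "set (v # R) = insert v (set R)" "last (v # R) = last R" using ne by auto
    ultimately show ?thesis by blast
  next
    case 2
    then have "rainbow (v # R) (insert e' K)" using R v e by (intro rainbow_path.step)
    moreover have "e \<notin> insert e' K" using e by auto
    moreover have "set (v # R) = insert v (set R)" "last (v # R) = last R" using ne by auto
    ultimately show ?thesis by blast
  next
    case 3
    obtain ws f where ws: "rainbow ws (insert e (insert e' (K - {f})))" "f \<in> K"
      "set ws = insert v (set R)" "last ws = last R"
      by (rule fits_insert[OF R(1) v(2) e(3,4,5) 3])
    then have "insert f (insert e (insert e' (K - {f}))) = insert e (insert e' K)"
      "f \<notin> insert e (insert e' (K - {f}))" using e by auto
    with ws show ?thesis by blast
  next
    case 4
    obtain ws f where ws: "rainbow ws (insert e' (insert e (K - {f})))" "f \<in> K"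
      "set ws = insert v (set R)" "last ws = last R"
      by (rule fits_insert[OF R(1) v(2) e(3)[symmetric] e(5,4) 4])
    then have "insert f (insert e' (insert e (K - {f}))) = insert e (insert e' K)"
      "f \<notin> insert e' (insert e (K - {f}))" using e by auto
    with ws show ?thesis by blast
  next
    case 5
    then have "arc e (hd R) v" "arc e' (hd R) v"
      using total[of e v "hd R"] total[of e' v "hd R"] R v e hd_in_set[OF ne]
      by (auto simp: subset_iff)
    then show ?thesis using no_fit_forward[of R v e e'] 5 R v e by blast
  qed
qed

lemma ex_rainbow_path:
  assumes "finite Z" "Z \<noteq> {}" "Z \<subseteq> V" "E \<subseteq> C" "card Z \<le> card E"
  shows "\<exists>vs K. rainbow vs K \<and> set vs = Z \<and> K \<subseteq> E"
  using assms
proof (induction rule: finite_ne_induct)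
  case (singleton x)
  then show ?case using rainbow_path.single[of arc x] by (intro exI[of _ "[x]"]) auto
next
  case (insert x F)
  then obtain vs K where vs: "rainbow vs K" "set vs = F" "K \<subseteq> E" by auto
  have finE: "finite E" using insert by (metis card.infinite card_gt_0_iff finite.insertI
    insert_not_empty le_zero_eq not_less)
  have "card (E - K) = card E - card K"
    using vs finE by (intro card_Diff_subset) (auto intro: finite_subset)
  \<comment> \<open>The path on \<open>F\<close> uses \<open>card F - 1\<close> colours, while
    \<open>E\<close> has at least \<open>card F + 1\<close>.\<close>
  then have "2 \<le> card (E - K)"
    using rainbow_path_card[OF vs(1)] insert vs by auto
  then obtain e e' where e: "e \<in> E - K" "e' \<in> E - K" "e \<noteq> e'"
    using card_le_Suc0_iff_eq[of "E - K"] finE by auto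
  consider vs' L f where "rainbow vs' L" "set vs' = insert x (set vs)"
      "insert f L = insert e (insert e' K)" | "\<forall>y\<in>set vs. arc e y x \<and> arc e' y x"
  proof -
    have "e \<in> C" "e' \<in> C" "x \<in> V" "x \<notin> set vs" "set vs \<subseteq> V"
      using e vs insert.hyps insert.prems by auto
    with extend_inside[of vs K x e e'] show ?thesis using vs(1) e that by blast
  qed
  then show ?case
  proof cases
    case 1
    have "insert f L \<subseteq> E" unfolding 1(3) using vs(3) e by auto
    with 1(1,2) vs(2) show ?thesis by blast
  next
    case 2
    then have "arc e (last vs) x" using rainbow_path_ne[OF vs(1)] by auto
    then have "rainbow (vs @ [x]) (insert e K)"
      using vs insert e by (intro rainbow_path_snoc) auto
    then show ?thesis using vs e by (intro exI[of _ "vs @ [x]"] exI[of _ "insert e K"]) auto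
  qed
qed

section \<open>Adding the two reserved vertices\<close>

text \<open>\<open>Q\<close> ends in \<open>Z\<close>, so adding \<open>a\<close> at the front or in
  a gap leaves a colour of \<open>E\<close> that leads from \<open>Z\<close> to \<open>w\<close>;
  with \<open>a\<close> at the end, \<open>d\<close> is left for this.\<close>

lemma absorb:
  assumes Q: "rainbow Q K" "set Q = insert b Z" "last Q \<in> Z" and Z: "b \<notin> Z" "insert b Z \<subseteq> V"
    and E: "K \<subseteq> E" "e \<in> E" "e \<notin> K" "E \<subseteq> C" and d: "d \<in> C" "d \<notin> E"
    and a: "a \<in> V" "a \<notin> insert b Z" "arc d a w"
    and w: "\<And>c z. c \<in> E \<Longrightarrow> z \<in> Z \<Longrightarrow> arc c z w"
  shows "\<exists>ws K c. rainbow ws K \<and> set ws = insert a (insert b Z) \<and> c \<notin> K \<and>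
    insert c K \<subseteq> insert d E \<and> arc c (last ws) w"
proof -
  have ne: "Q \<noteq> []" using Q rainbow_path_ne by blast
  have dK: "d \<notin> K" "d \<noteq> e" "e \<in> C" using E d by auto
  have goal_Z: ?thesis if "rainbow ws L" "set ws = insert a (insert b Z)" "last ws \<in> Z"
    "L \<subseteq> insert d E" "f \<in> E" "f \<notin> L" for ws L f
    using that w by blast
  have goal_fits: ?thesis if fit: "fits a c c' Q" and cc: "{c, c'} = {d, e}" for c c'
  proof -
    have new: "a \<notin> set Q" "c \<noteq> c'" "c \<notin> K" "c' \<notin> K"
      using Q(2) a(2) cc dK E(3) by (auto simp: doubleton_eq_iff)
    obtain ws f where ws: "rainbow ws (insert c (insert c' (K - {f})))" "f \<in> K"
      "set ws = insert a (set Q)" "last ws = last Q"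
      by (rule fits_insert[OF Q(1) new fit])
    have "insert c (insert c' (K - {f})) = insert d (insert e (K - {f}))" using cc by auto
    then have "rainbow ws (insert d (insert e (K - {f})))" using ws by simp
    then show ?thesis
      by (rule goal_Z[where f = f]) (use ws Q E d in auto)
  qed
  consider "arc e (last Q) a" | "arc d a (hd Q)" | "fits a d e Q" | "fits a e d Q"
    | "\<not> arc e (last Q) a" "\<not> arc d a (hd Q)" "\<not> fits a d e Q" "\<not> fits a e d Q"
    by blast
  then show ?thesis
  proof cases
    case 1
    then have "rainbow (Q @ [a]) (insert e K)" using Q E a by (intro rainbow_path_snoc) auto
    moreover have "d \<notin> insert e K" "insert d (insert e K) \<subseteq> insert d E" using dK E by auto
    moreover have "set (Q @ [a]) = insert a (insert b Z)" "last (Q @ [a]) = a" using Q by auto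
    ultimately show ?thesis using a(3) by metis
  next
    case 2
    then have "rainbow (a # Q) (insert d K)" using Q dK a by (intro rainbow_path.step) auto
    then show ?thesis
      by (rule goal_Z[where f = e]) (use Q E dK ne in auto)
  next
    case 3
    then show ?thesis by (rule goal_fits) simp
  next
    case 4
    then show ?thesis by (rule goal_fits) (simp add: insert_commute)
  next
    case 5
    have Qin: "set Q \<subseteq> V" "a \<notin> set Q" using Q Z a by auto
    have ends: "hd Q \<in> V" "last Q \<in> V" "hd Q \<noteq> a" "last Q \<noteq> a"
      using hd_in_set[OF ne] last_in_set[OF ne] Qin by auto
    have first: "arc d (hd Q) a" and final: "arc e a (last Q)"
      using 5 total[of d a "hd Q"] total[of e a "last Q"] ends d(1) dK(3) a(1) by auto
    \<comment> \<open>In \<open>d\<close>, an arc from \<open>a\<close> to \<open>last Q\<close>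
      would propagate back to \<open>hd Q\<close>, which the case excludes. The same argument
      forwards in \<open>e\<close> gives the arc from \<open>a\<close> to
      \<open>hd Q\<close>.\<close>
    have "\<not> arc d a (last Q)"
      using no_fit_backward[OF Qin(1) a(1) Qin(2) d(1) dK(3) 5(3,4) _ final hd_in_set[OF ne]] 5(2)
      by blast
    then have rot1: "arc d (last Q) a" using total[of d a "last Q"] ends d(1) a(1) by auto
    have "\<not> arc e (hd Q) a"
      using no_fit_forward[OF Qin(1) a(1) Qin(2) d(1) dK(3) 5(3,4) first _ last_in_set[OF ne]] 5(1)
      by blast
    then have rot2: "arc e a (hd Q)" using total[of e a "hd Q"] ends dK(3) a(1) by auto
    have dist: "distinct Q" using Q rainbow_path_distinct by blast
    \<comment> \<open>\<open>Q\<close> closes to a cycle through \<open>a\<close>, which is cut open after a vertex of \<open>Z\<close>.\<close>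
    obtain us z where us: "Q = us @ [z]" using ne by (meson rev_exhaust)
    have "us \<noteq> []" using us Q Z by auto
    obtain xs ys where xy: "Q = xs @ ys" "xs \<noteq> []" "ys \<noteq> []" "last xs \<in> Z"
    proof (cases "last us \<in> Z")
      case True
      then show ?thesis using that[of us "[z]"] us \<open>us \<noteq> []\<close> by auto
    next
      case False
      then have "last us = b" using last_in_set[OF \<open>us \<noteq> []\<close>] us Q by auto
      then obtain us' where us': "us = us' @ [b]" using \<open>us \<noteq> []\<close> by (metis append_butlast_last_id)
      \<comment> \<open>Otherwise \<open>Q = [b, z]\<close>, and \<open>a\<close> fits between,
        entered in \<open>d\<close> and left in \<open>e\<close>.\<close>
      have "us' \<noteq> []"
        using 5(3) first final us us' fitsI[of "[b]" "[z]" d a e] by auto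
      moreover have "last us' \<in> Z"
        using last_in_set[OF calculation] us us' dist Q(2) by auto
      ultimately show ?thesis using that[of us' "[b, z]"] us us' by auto
    qed
    obtain L M f where LM: "rainbow xs L" "rainbow ys M" "K = insert f (L \<union> M)"
      "f \<notin> L" "f \<notin> M" "L \<inter> M = {}"
      using rainbow_path_split[of arc xs ys K] Q xy by metis
    have "rainbow (a # xs) (insert e L)"
      using LM(1,3) xy(1,2) Qin(2) rot2 E(3) by (intro rainbow_path.step) auto
    then have "rainbow (ys @ a # xs) (insert d (M \<union> insert e L))"
      using LM(2,3,6) xy(1,3) Qin(2) rot1 E(3) dK dist by (intro rainbow_path_join) auto
    then show ?thesis
    proof (rule goal_Z[where f = f])
      show "set (ys @ a # xs) = insert a (insert b Z)" using xy(1) Q(2) by auto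
    qed (use xy LM E d in auto)
  qed
qed

text \<open>\<open>ws\<close> is to precede a path starting at \<open>w\<close>, joined by colour
  \<open>c\<close>. Together they take \<open>card Z + 2\<close> colours, which is all of
  \<open>insert d E\<close>.\<close>

lemma endgame:
  assumes Z: "finite Z" "Z \<subseteq> V" "\<And>c z. c \<in> E \<Longrightarrow> z \<in> Z \<Longrightarrow> arc c z w"
    and ab: "a \<in> V" "b \<in> V" "a \<noteq> b" "a \<notin> Z" "b \<notin> Z" "arc d a w" "arc d b w"
    and E: "finite E" "E \<subseteq> C" "card E = Suc (card Z)" and d: "d \<in> C" "d \<notin> E"
  shows "\<exists>ws K c. rainbow ws K \<and> set ws = insert a (insert b Z) \<and> c \<notin> K \<and>
    insert c K \<subseteq> insert d E \<and> arc c (last ws) w"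
    (is ?goal)
proof (cases "Z = {}")
  case True
  then obtain e where e: "E = {e}" using E by (auto simp: card_1_singleton_iff)
  obtain x y where xy: "{x, y} = {a, b}" "arc e x y"
    using total[of e a b] e E ab by (metis insert_commute insert_subset)
  then have neq: "x \<noteq> y" using ab by (auto simp: doubleton_eq_iff)
  have "rainbow ([x] @ [y]) (insert e {})"
    using neq xy(2) by (intro rainbow_path_snoc rainbow_path.single) auto
  moreover have "arc d y w" using xy ab by (auto simp: doubleton_eq_iff)
  ultimately show ?thesis using True e d xy(1)
    by (intro exI[of _ "[x] @ [y]"] exI[of _ "{e}"] exI[of _ d]) auto
next
  case False
  then obtain R K where R: "rainbow R K" "set R = Z" "K \<subseteq> E"
    using ex_rainbow_path[of Z E] Z E by auto
  have ne: "R \<noteq> []" using R rainbow_path_ne by blast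
  then have lastR: "last R \<in> Z" using R last_in_set by blast
  have "card (E - K) = card E - card K"
    using R E by (intro card_Diff_subset) (auto intro: finite_subset)
  then have "card (E - K) = 2" using rainbow_path_card[OF R(1)] R(2) E(3) by simp
  then obtain e e' where ee: "E - K = {e, e'}" "e \<noteq> e'" by (auto simp: card_2_iff)
  then have e: "e \<in> C" "e' \<in> C" "e \<noteq> e'" "e \<notin> K" "e' \<notin> K" "insert e (insert e' K) = E"
    using E R by auto
  \<comment> \<open>If \<open>y\<close> goes in before the end, the leftover \<open>f\<close> is the
    spare colour with which \<open>absorb\<close> adds \<open>x\<close>.\<close>
  have step: "?goal \<or> arc e (last R) y \<and> arc e' (last R) y"
    if xy: "{x, y} = {a, b}" "x \<noteq> y" for x y
  proof -
    have x: "x \<in> V" "x \<notin> insert y Z" "arc d x w" and y: "y \<in> V" "y \<notin> Z"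
      using xy ab by (auto simp: doubleton_eq_iff)
    have ins: "insert x (insert y Z) = insert a (insert b Z)" using xy(1) by auto
    consider vs L f where "rainbow vs L" "set vs = insert y Z" "last vs = last R"
        "insert f L = E" "f \<notin> L" | "arc e (last R) y \<and> arc e' (last R) y"
      using extend_inside[of R K y e e'] R Z(2) y e ne e last_in_set[OF ne] by auto
    then show ?thesis
    proof cases
      case 1
      have ?goal
        using absorb[of vs L y Z E f d x w] 1 x y Z lastR E d unfolding ins by auto
      then show ?thesis ..
    qed simp
  qed
  \<comment> \<open>Here \<open>R\<close> and the two added arcs exhaust \<open>E\<close>, so
    \<open>d\<close> is left to reach \<open>w\<close>.\<close>
  have goal: ?goal if xy: "{x, y} = {a, b}" "x \<noteq> y" "arc e (last R) x" "arc e' x y" for x y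
  proof -
    have new: "x \<notin> set R" "y \<notin> set (R @ [x])" using xy R ab by (auto simp: doubleton_eq_iff)
    have "rainbow ((R @ [x]) @ [y]) (insert e' (insert e K))"
      using rainbow_path_snoc[OF rainbow_path_snoc[OF R(1) new(1) e(4) xy(3)] new(2), of e'] e xy(4)
      by auto
    then have "rainbow ((R @ [x]) @ [y]) E" using e(6) by (simp add: insert_commute)
    moreover have "set ((R @ [x]) @ [y]) = insert a (insert b Z)" using R xy(1) by auto
    moreover have "arc d (last ((R @ [x]) @ [y])) w" using xy ab by (auto simp: doubleton_eq_iff)
    ultimately show ?thesis using d by blast
  qed
  show ?thesis
    using step[of a b] step[of b a] goal[of a b] goal[of b a] total[of e' a b] ab(1-3) e(2)
    by (auto simp: insert_commute)
qed

section \<open>Choosing the reserved vertices and assembling the path\<close>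

text \<open>Four vertices span six arcs, so one of them has two in-neighbours.\<close>

lemma ex_common_in_neighbours:
  assumes "d \<in> C" "finite V" "4 \<le> card V"
  obtains a b w where "a \<in> V" "b \<in> V" "w \<in> V" "a \<noteq> b" "a \<noteq> w" "b \<noteq> w" "arc d a w" "arc d b w"
proof -
  obtain W where W: "W \<subseteq> V" "card W = 4" using assms by (meson obtain_subset_with_card_n)
  then obtain w x y z where "W = {w, x, y, z}" "distinct [w, x, y, z]"
    by (auto simp: card_Suc_eq numeral_eq_Suc)
  then have *: "w \<in> V" "x \<in> V" "y \<in> V" "z \<in> V" "distinct [w, x, y, z]" using W by auto
  have "arc d u v \<or> arc d v u" if "u \<in> V" "v \<in> V" "u \<noteq> v" for u v
    using total assms(1) that by blast
  note this[of w x] this[of w y] this[of w z] this[of x y] this[of x z] this[of y z]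
  then show ?thesis using that * by auto
qed

lemma ex_rainbow_hamilton_path:
  assumes V: "finite V" "4 \<le> card V" and C: "Suc (card C) = card V"
  shows "\<exists>vs. rainbow vs C \<and> set vs = V"
proof -
  have finC: "finite C" using V C by (metis Suc_le_eq card.infinite not_less numeral_le_one_iff
    One_nat_def semiring_norm(69))
  obtain d where d: "d \<in> C" using V C by fastforce
  obtain a b w where ab: "a \<in> V" "b \<in> V" "w \<in> V" "a \<noteq> b" "a \<noteq> w" "b \<noteq> w"
    "arc d a w" "arc d b w" using ex_common_in_neighbours[OF d V] .
  define P where "P vs \<longleftrightarrow> (\<exists>K. rainbow vs K \<and> hd vs = w \<and> set vs \<subseteq> V - {a, b} \<and>
    K \<subseteq> C - {d})" for vs
  have "P [w]" unfolding P_def using rainbow_path.single[of arc w] ab by auto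
  moreover have "length vs < Suc (card V)" if Pvs: "P vs" for vs
  proof -
    obtain K where "rainbow vs K" "set vs \<subseteq> V" using Pvs unfolding P_def by blast
    then show ?thesis
      using card_mono[OF V(1), of "set vs"] distinct_card[of vs] rainbow_path_distinct[of arc vs K]
      by simp
  qed
  ultimately obtain Y where PY: "P Y" and max: "\<And>vs. P vs \<Longrightarrow> length vs \<le> length Y"
    using Lattices_Big.ex_has_greatest_nat[of P "[w]" length "Suc (card V)"] by blast
  obtain K where Y: "rainbow Y K" "hd Y = w" "set Y \<subseteq> V - {a, b}" "K \<subseteq> C - {d}"
    using PY unfolding P_def by blast
  have ne: "Y \<noteq> []" using Y rainbow_path_ne by blast
  define Z where "Z = V - {a, b} - set Y"
  define E where "E = C - {d} - K"
  have ZE: "finite Z" "Z \<subseteq> V" "a \<notin> Z" "b \<notin> Z" "Z \<inter> set Y = {}" "finite E" "E \<subseteq> C" "d \<notin> E"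
    "E \<inter> K = {}" unfolding Z_def E_def using V finC by auto
  have "card Z = card V - 2 - Suc (card K)"
    unfolding Z_def using Y(3) V ab rainbow_path_card[OF Y(1)]
    by (subst card_Diff_subset) (auto simp: card_Diff_subset)
  moreover have "card E = card C - 1 - card K"
    unfolding E_def using Y(4) finC d rainbow_path_finite[OF Y(1)]
    by (subst card_Diff_subset) (auto simp: card_Diff_subset)
  \<comment> \<open>Keeps the truncated subtraction in \<open>card Z\<close> exact.\<close>
  moreover have "Suc (card K) \<le> card V - 2"
    using card_mono[OF _ Y(3)] V ab rainbow_path_card[OF Y(1)] by (simp add: card_Diff_subset)
  ultimately have cardE: "card E = Suc (card Z)" using C by linarith
  have longer: False if "rainbow vs L" "hd vs = w" "set vs = insert z (set Y)" "L \<subseteq> C - {d}" "z \<in> Z"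
    for vs L z
  proof -
    have "set vs \<subseteq> V - {a, b}" unfolding that(3) using Y(3) that(5) by (auto simp: Z_def)
    then have "P vs" unfolding P_def using that(1,2,4) by blast
    then have "card (set vs) \<le> card (set Y)"
      using max that(1) Y(1) by (metis distinct_card rainbow_path_distinct)
    moreover have "z \<notin> set Y" using that(5) ZE(5) by blast
    ultimately show False using that(3) by simp
  qed
  have Zw: "arc e z w" if z: "z \<in> Z" and e: "e \<in> E" for e z
  proof (rule ccontr)
    assume *: "\<not> arc e z w"
    \<comment> \<open>Since \<open>Z\<close> is nonempty, \<open>E\<close> has a second colour
      \<open>e'\<close>. By maximality \<open>z\<close> fits neither at the end nor in a gap, so it
      points to \<open>last Y\<close> in both colours, and this propagates back to
      \<open>hd Y = w\<close>.\<close>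
    have "card Z \<noteq> 0" using z ZE(1) by auto
    then have "E \<noteq> {e}" using cardE by auto
    then obtain e' where e': "e' \<in> E" "e' \<noteq> e" using e by blast
    have zY: "z \<in> V" "z \<notin> set Y" "set Y \<subseteq> V" using z ZE Y by auto
    have eC: "e \<in> C" "e' \<in> C" "e \<in> C - {d} - K" "e' \<in> C - {d} - K" using e e' ZE E_def by auto
    have snoc: "\<not> arc c (last Y) z" if "c \<in> E" for c
    proof
      assume "arc c (last Y) z"
      then have "rainbow (Y @ [z]) (insert c K)"
        using Y zY that by (intro rainbow_path_snoc) (auto simp: E_def)
      then show False using longer[of "Y @ [z]" _ z] Y z that ne by (auto simp: E_def)
    qed
    have nofit: "\<not> fits z c c' Y" if cc: "c \<in> E" "c' \<in> E" "c \<noteq> c'" for c c'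
    proof
      assume fit: "fits z c c' Y"
      have cK: "c \<notin> K" "c' \<notin> K" using cc by (auto simp: E_def)
      obtain ws f where ws: "rainbow ws (insert c (insert c' (K - {f})))"
        "set ws = insert z (set Y)" "hd ws = hd Y"
        by (rule fits_insert[OF Y(1) zY(2) cc(3) cK fit])
      then show False using longer[OF ws(1)] ws Y z cc by (auto simp: E_def)
    qed
    have "arc e z (last Y)" "arc e' z (last Y)"
      using snoc[OF e] snoc[OF e'(1)] total[of e z "last Y"] total[of e' z "last Y"] eC zY
        last_in_set[OF ne] by (auto simp: subset_iff)
    then have "arc e z (hd Y)"
      using no_fit_backward[OF zY(3,1,2) eC(1,2) nofit nofit _ _ hd_in_set[OF ne]] e e' by blast
    then show False using * Y(2) by simp
  qed
  obtain ws L c where ws: "rainbow ws L" "set ws = insert a (insert b Z)" "c \<notin> L"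
    "insert c L \<subseteq> insert d E" "arc c (last ws) w"
    using endgame[of Z E w a b d] ZE Zw ab cardE d by blast
  have disj: "set ws \<inter> set Y = {}" "L \<inter> K = {}" "c \<notin> K"
    using ws ZE Y by (auto simp: E_def)
  have path: "rainbow (ws @ Y) (insert c (L \<union> K))"
    using ws disj Y by (intro rainbow_path_join) auto
  have all: "set (ws @ Y) = V" using ws(2) Y(3) ab by (auto simp: Z_def)
  have "insert c (L \<union> K) \<subseteq> C" using ws Y ZE d by auto
  \<comment> \<open>A path through all of \<open>V\<close> uses \<open>card V - 1\<close> colours,
    hence every colour.\<close>
  moreover have "card (insert c (L \<union> K)) = card C" using rainbow_path_card[OF path] all C by simp
  ultimately have "insert c (L \<union> K) = C" using finC by (simp add: card_subset_eq)
  then show ?thesis using path all by auto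
qed

end

section \<open>From rainbow paths to transversal digraphs\<close>

theorem theorem1p3:
  shows "\<exists>n0::nat. \<forall>n\<ge>n0. \<forall>(V::'a set) (T::nat \<Rightarrow> 'a pair_pre_digraph).
    finite V \<longrightarrow> card V = n \<longrightarrow> tournament_collection V (n - 1) T \<longrightarrow>
    (\<exists>D. transversal V (n - 1) T D \<and> directed_hamilton_path V D)"
proof (intro exI[of _ 4] allI impI)
  \<comment> \<open>The threshold 4 guarantees a vertex with two in-neighbours.\<close>
  fix n :: nat and V :: "'a set" and T :: "nat \<Rightarrow> 'a pair_pre_digraph"
  assume n: "4 \<le> n" and V: "finite V" "card V = n" and T: "tournament_collection V (n - 1) T"
  let ?arc = "\<lambda>i u v. (u, v) \<in> parcs (T i)"
  have tour: "tournament (T i)" "pverts (T i) = V" if "i \<in> {1..n - 1}" for i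
    using T that unfolding tournament_collection_def by auto
  interpret coloured_tournaments ?arc "{1..n - 1}" V
  proof unfold_locales
    fix c u v assume "c \<in> {1..n - 1}" "u \<in> V" "v \<in> V" "u \<noteq> v"
    then show "(u, v) \<in> parcs (T c) \<or> (v, u) \<in> parcs (T c)"
      using tournament.exactly_one_arc[of "T c" u v] tour[of c] by auto
  qed
  obtain vs where vs: "rainbow vs {1..n - 1}" "set vs = V"
    using ex_rainbow_hamilton_path n V by auto
  obtain \<phi> where \<phi>: "bij_betw \<phi> (set (vwalk_arcs vs)) {1..n - 1}"
    "\<forall>(u, v) \<in> set (vwalk_arcs vs). ?arc (\<phi> (u, v)) u v"
    using rainbow_path_transversal[OF vs(1)] by blast
  have dist: "distinct vs" "vs \<noteq> []"
    using vs(1) rainbow_path_distinct rainbow_path_ne by blast+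
  let ?D = "\<lparr>pverts = V, parcs = set (vwalk_arcs vs)\<rparr>"
  have "x \<noteq> y" if "(x, y) \<in> set (vwalk_arcs vs)" for x y
    using that dist(1) by (induction vs rule: vwalk_arcs.induct) auto
  then have "pair_digraph ?D"
    using vs(2) V(1) by unfold_locales (auto dest: vwalk_arcs_verts)
  moreover have "card (set (vwalk_arcs vs)) = n - 1"
    using bij_betw_same_card[OF \<phi>(1)] by simp
  ultimately have "transversal V (n - 1) T ?D"
    unfolding transversal_def using \<phi> by auto
  moreover have "directed_hamilton_path V ?D"
    unfolding directed_hamilton_path_def using vs(2) dist
    by (auto simp: vpath_def vwalk_def intro!: exI[of _ vs])
  ultimately show "\<exists>D. transversal V (n - 1) T D \<and> directed_hamilton_path V D" by blast
qed

end
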